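(* Let $\mathbb{U}$ be the Urysohn space and let $A,B\subseteq\mathbb{U}$ be finite sets. Then $$\mathrm{Iso}(\mathbb{U}|A\cap B)=\langle \mathrm{Iso}(\mathbb{U}|A),\mathrm{Iso}(\mathbb{U}|B)\rangle,$$ where $\langle \mathrm{Iso}(\mathbb{U}|A),\mathrm{Iso}(\mathbb{U}|B)\rangle$ denotes the closed subgroup of $\mathrm{Iso}(\mathbb{U})$ generated by $\mathrm{Iso}(\mathbb{U}|A)\cup\mathrm{Iso}(\mathbb{U}|B)$.
   Context: A Polish metric space is a separable complete metric space. For a metric space $A$, a Katětov map on $A$ is a function $f\colon A\to\mathbb{R}$ with $|f(x)-f(y)|\le d(x,y)\le f(x)+f(y)$ for all $x,y\in A$; $E(A)$ denotes the set of Katětov maps on $A$. The Urysohn space $\mathbb{U}$ is the unique (up to isometry) Polish metric space such that for every finite $A\subset\mathbb{U}$ and every $f\in E(A)$ there is $z\in\mathbb{U}$ with $d(z,a)=f(a)$ for all $a\in A$; equivalently, it is the unique Polish metric space that is universal (every Polish metric space embeds isometrically into it) and ultrahomogeneous (every isometry between finite subsets extends to an isometry of the whole space). $\mathrm{Iso}(\mathbb{U})$ is the group of all distance-preserving bijections $\mathbb{U}\to\mathbb{U}$, with the topology of pointwise convergence (with respect to the metric topology on $\mathbb{U}$). For $A\subseteq\mathbb{U}$, $\mathrm{Iso}(\mathbb{U}|A)$ is the set of $g\in\mathrm{Iso}(\mathbb{U})$ with $g(a)=a$ for all $a\in A$ (so $\mathrm{Iso}(\mathbb{U}|\emptyset)=\mathrm{Iso}(\mathbb{U})$).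 The closed subgroup generated by a set is the closure of the subgroup it generates. *)

theory Defs
  imports "HOL-Analysis.Analysis" "HOL-Algebra.Generated_Groups"
begin

definition katetov_on :: "'a::metric_space set \<Rightarrow> ('a \<Rightarrow> real) \<Rightarrow> bool" where
  "katetov_on A f \<longleftrightarrow>
     (\<forall>x\<in>A. \<forall>y\<in>A. \<bar>f x - f y\<bar> \<le> dist x y \<and> dist x y \<le> f x + f y)"

text \<open>The Urysohn space, characterised up to isometry by the extension property for
  Katetov maps. The whole type is the space; \<^class>\<open>polish_space\<close> provides a complete metric
  whose topology is second countable, equivalently separable.\<close>

class urysohn_space = polish_space +
  assumes katetov_extension:
    "finite A \<Longrightarrow> katetov_on A f \<Longrightarrow> \<exists>z. \<forall>a\<in>A. dist z a = f a"

definition Iso :: "('a::metric_space \<Rightarrow> 'a) set" where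
  "Iso = {g. bij g \<and> (\<forall>x y. dist (g x) (g y) = dist x y)}"

definition Iso_group :: "('a::metric_space \<Rightarrow> 'a) monoid" where
  "Iso_group = \<lparr>carrier = Iso, mult = (\<circ>), one = id\<rparr>"

definition Iso_fix :: "'a::metric_space set \<Rightarrow> ('a \<Rightarrow> 'a) set" where
  "Iso_fix A = {g \<in> Iso. \<forall>a\<in>A. g a = a}"

text \<open>The library topology on a function type is the product topology, so the subspace topology
  on \<^const>\<open>Iso\<close> is the topology of pointwise convergence.\<close>

definition closed_subgroup_generated :: "('a::metric_space \<Rightarrow> 'a) set \<Rightarrow> ('a \<Rightarrow> 'a) set" where
  "closed_subgroup_generated S = top_of_set Iso closure_of generate Iso_group S"

lemma group_Iso_group: "group (Iso_group :: ('a::metric_space \<Rightarrow> 'a) monoid)"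
proof (rule groupI)
  fix g :: "'a \<Rightarrow> 'a"
  assume "g \<in> carrier Iso_group"
  then have g: "bij g" "\<And>x y. dist (g x) (g y) = dist x y"
    by (auto simp: Iso_group_def Iso_def)
  have "dist (inv_into UNIV g x) (inv_into UNIV g y) = dist x y" for x y
    using g(2)[of "inv_into UNIV g x" "inv_into UNIV g y"] g(1) by (simp add: bij_is_surj surj_f_inv_f)
  moreover have "inv_into UNIV g \<circ> g = id"
    using g(1) by (simp add: bij_is_inj)
  ultimately show "\<exists>h\<in>carrier Iso_group. h \<otimes>\<^bsub>Iso_group\<^esub> g = \<one>\<^bsub>Iso_group\<^esub>"
    using g(1) by (intro bexI[of _ "inv_into UNIV g"]) (auto simp: Iso_group_def Iso_def bij_imp_bij_inv)
qed (auto simp: Iso_group_def Iso_def bij_comp o_assoc)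

end

theory Submission imports Defs begin

text \<open>
  The subgroup generated by the two stabilisers agrees with the stabiliser of \<open>A \<inter> B\<close> on every
  finite set, even before taking closures. Given a finite set \<open>F\<close>, an element of \<open>Iso_fix A\<close> moves \<open>F\<close>
  to a position amalgamated as freely as possible with \<open>B\<close> over \<open>A\<close>, with distances capped at a
  bound \<open>M\<close> for the diameter of the configuration; then the roles of \<open>A\<close> and \<open>B\<close> are exchanged.
  After each move a distance from \<open>F\<close> to the other set is the length of a path zigzagging between
  \<open>A\<close> and \<open>B\<close>, unless it is \<open>M\<close> or realised through \<open>A \<inter> B\<close>. Each zigzag costs at least the
  least positive distance between \<open>A\<close> and \<open>B\<close>, so after finitely many moves the distances from \<open>F\<close>
  to \<open>A \<union> B\<close> depend only on the distances from \<open>F\<close> to \<open>A \<inter> B\<close>. An isometry \<open>g\<close> fixing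
  \<open>A \<inter> B\<close> does not change the latter, so \<open>F\<close> and \<open>g ` F\<close> reach positions which, by
  ultrahomogeneity, are conjugate over \<open>A \<union> B\<close>.
\<close>

section \<open>Realising pseudometrics\<close>

text \<open>Distance 0 between distinct indices must be allowed: in the amalgam below, the two
  copies of a point of \<open>A \<inter> Q\<close> coincide.\<close>

definition pseudometric_on :: "'i set \<Rightarrow> ('i \<Rightarrow> 'i \<Rightarrow> real) \<Rightarrow> bool" where
  "pseudometric_on I \<rho> \<longleftrightarrow> (\<forall>i\<in>I. \<rho> i i = 0) \<and> (\<forall>i\<in>I. \<forall>j\<in>I. \<rho> i j = \<rho> j i) \<and>
     (\<forall>i\<in>I. \<forall>j\<in>I. \<forall>k\<in>I. \<rho> i k \<le> \<rho> i j + \<rho> j k)"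

text \<open>A relation keeps both sides symmetric: for \<open>\<rho> = dist\<close> it is a partial
  isometry, and so is its converse.\<close>

definition realizes :: "('i \<Rightarrow> 'i \<Rightarrow> real) \<Rightarrow> ('i \<times> 'a::metric_space) set \<Rightarrow> bool" where
  "realizes \<rho> E \<longleftrightarrow> (\<forall>i x j y. (i, x) \<in> E \<longrightarrow> (j, y) \<in> E \<longrightarrow> dist x y = \<rho> i j)"

lemma realizesD: "realizes \<rho> E \<Longrightarrow> (i, x) \<in> E \<Longrightarrow> (j, y) \<in> E \<Longrightarrow> dist x y = \<rho> i j"
  unfolding realizes_def by blast

lemma pseudometric_on_subset: "pseudometric_on J \<rho> \<Longrightarrow> I \<subseteq> J \<Longrightarrow> pseudometric_on I \<rho>"
  unfolding pseudometric_on_def by blast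

lemma pseudometric_on_dist: "pseudometric_on I dist"
  unfolding pseudometric_on_def by (simp add: dist_commute dist_triangle)

lemma realizes_converse: "realizes dist E \<Longrightarrow> realizes dist (E\<inverse>)"
  unfolding realizes_def by simp

text \<open>The prescribed distances from \<open>k\<close> form a Katetov map on the points already
  placed, its inequalities being triangle inequalities of \<open>\<rho>\<close>.\<close>

lemma one_point_extension:
  fixes E :: "('i \<times> 'a::urysohn_space) set"
  assumes "finite E" "realizes \<rho> E" "pseudometric_on (insert k (Domain E)) \<rho>"
  shows "\<exists>z. realizes \<rho> (insert (k, z) E)"
proof -
  let ?I = "insert k (Domain E)"
  have refl: "\<And>i. i \<in> ?I \<Longrightarrow> \<rho> i i = 0"
    and sym: "\<And>i j. i \<in> ?I \<Longrightarrow> j \<in> ?I \<Longrightarrow> \<rho> i j = \<rho> j i"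
    and tri: "\<And>i j l. i \<in> ?I \<Longrightarrow> j \<in> ?I \<Longrightarrow> l \<in> ?I \<Longrightarrow> \<rho> i l \<le> \<rho> i j + \<rho> j l"
    using assms(3) unfolding pseudometric_on_def by blast+
  \<comment> \<open>A point may carry several indices; they are at \<open>\<rho>\<close>-distance 0,
    so the choice does not affect the value.\<close>
  define f where "f y = \<rho> k (SOME i. (i, y) \<in> E)" for y
  have f: "f y = \<rho> k i" if "(i, y) \<in> E" for i y
  proof -
    define j where "j = (SOME i. (i, y) \<in> E)"
    have j: "(j, y) \<in> E"
      unfolding j_def using that by (rule someI)
    have "\<rho> i j = 0"
      using realizesD[OF assms(2) that j] by simp
    then have "\<rho> k j = \<rho> k i"
      using tri[of k i j] tri[of k j i] sym[of i j] that j by (auto simp: Domain.intros)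
    then show ?thesis
      by (simp add: f_def j_def)
  qed
  have "katetov_on (Range E) f"
    unfolding katetov_on_def
  proof (intro ballI)
    fix x y
    assume "x \<in> Range E" "y \<in> Range E"
    then obtain i j where ij: "(i, x) \<in> E" "(j, y) \<in> E"
      by blast
    then have "i \<in> insert k (Domain E)" "j \<in> insert k (Domain E)"
      by blast+
    then show "\<bar>f x - f y\<bar> \<le> dist x y \<and> dist x y \<le> f x + f y"
      using tri[of k i j] tri[of k j i] tri[of i k j] sym[of i j] sym[of k i]
        f[OF ij(1)] f[OF ij(2)] realizesD[OF assms(2) ij] by auto
  qed
  moreover have "finite (Range E)"
    using assms(1) by (simp add: finite_Range)
  ultimately obtain z where z: "\<And>y. y \<in> Range E \<Longrightarrow> dist z y = f y"
    using katetov_extension by metis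
  have "dist z y = \<rho> k j" if "(j, y) \<in> E" for j y
    using z[of y] f[OF that] that by auto
  moreover have "\<rho> j k = \<rho> k j" if "(j, y) \<in> E" for j y
    using sym that by blast
  moreover have "\<rho> k k = 0"
    using refl by blast
  ultimately have "realizes \<rho> (insert (k, z) E)"
    using assms(2) unfolding realizes_def by (auto simp: dist_commute)
  then show ?thesis ..
qed

lemma realization_extension:
  fixes E :: "('i \<times> 'a::urysohn_space) set"
  assumes "finite J" "finite E" "realizes \<rho> E" "pseudometric_on (J \<union> Domain E) \<rho>"
  shows "\<exists>E'. finite E' \<and> E \<subseteq> E' \<and> realizes \<rho> E' \<and> Domain E' = J \<union> Domain E"
  using assms(1,4)
proof (induction J rule: finite_induct)
  case empty
  then show ?case using assms by auto
next
  case (insert k J)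
  have "pseudometric_on (J \<union> Domain E) \<rho>"
    by (rule pseudometric_on_subset[OF insert.prems]) blast
  from insert.IH[OF this] obtain E' where
    E': "finite E'" "E \<subseteq> E'" "realizes \<rho> E'" "Domain E' = J \<union> Domain E"
    by blast
  moreover obtain z where "realizes \<rho> (insert (k, z) E')"
    using one_point_extension[OF E'(1,3), of k] insert.prems E'(4) by auto
  ultimately show ?case
    by (intro exI[of _ "insert (k, z) E'"]) auto
qed

section \<open>Ultrahomogeneity\<close>

text \<open>If points of the domain converge to \<open>x\<close>, their partners form a Cauchy
  sequence because \<open>R\<close> preserves distances; its limit is \<open>y\<close>.\<close>

lemma limit_point_transfer:
  fixes R :: "('a::metric_space \<times> 'b::complete_space) set"
  assumes R: "\<And>p q p' q'. (p, q) \<in> R \<Longrightarrow> (p', q') \<in> R \<Longrightarrow> dist p p' = dist q q'"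
    and dense: "closure (Domain R) = UNIV"
  shows "\<exists>y. \<forall>p q. (p, q) \<in> R \<longrightarrow> dist x p = dist y q"
proof -
  obtain u where u: "\<And>n. u n \<in> Domain R" "u \<longlonglongrightarrow> x"
    using dense closure_sequential[of x "Domain R"] by auto
  then have "\<forall>n. \<exists>y. (u n, y) \<in> R"
    by blast
  then obtain v where v: "\<And>n. (u n, v n) \<in> R"
    by metis
  have "Cauchy u"
    using u(2) LIMSEQ_imp_Cauchy by blast
  then have "Cauchy v"
    unfolding Cauchy_def using R[OF v v] by simp
  then obtain y where y: "v \<longlonglongrightarrow> y"
    using Cauchy_convergent_iff convergent_def by blast
  have "dist x p = dist y q" if "(p, q) \<in> R" for p q
  proof (rule LIMSEQ_unique)
    show "(\<lambda>n. dist (u n) p) \<longlonglongrightarrow> dist x p"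
      by (intro tendsto_intros u)
    show "(\<lambda>n. dist (u n) p) \<longlonglongrightarrow> dist y q"
      unfolding R[OF v that] by (intro tendsto_intros y)
  qed
  then show ?thesis by blast
qed

text \<open>Density of the domain makes the limit map \<open>g\<close> distance-preserving; density
  of the range makes it onto.\<close>

lemma dense_partial_isometry_extends:
  fixes R :: "('a::complete_space \<times> 'a) set"
  assumes R: "realizes dist R"
    and dense: "closure (Domain R) = UNIV" "closure (Range R) = UNIV"
  shows "\<exists>g\<in>Iso. \<forall>p q. (p, q) \<in> R \<longrightarrow> g p = q"
proof -
  have RD: "dist p p' = dist q q'" if "(p, q) \<in> R" "(p', q') \<in> R" for p q p' q'
    using realizesD[OF R that] by simp
  have "\<forall>x. \<exists>y. \<forall>p q. (p, q) \<in> R \<longrightarrow> dist x p = dist y q"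
    using limit_point_transfer[of R, OF RD dense(1)] by blast
  then obtain g where g: "\<And>x p q. (p, q) \<in> R \<Longrightarrow> dist x p = dist (g x) q"
    by metis
  have "dist (g x) (g y) = dist x y" for x y
  proof -
    have "\<bar>dist (g x) (g y) - dist x y\<bar> \<le> 0 + e" if "e > 0" for e
    proof -
      have "y \<in> closure (Domain R)"
        using dense(1) by simp
      then have "\<exists>p\<in>Domain R. dist p y < e / 2"
        unfolding closure_approachable using half_gt_zero[OF that] by blast
      then obtain p q where pq: "(p, q) \<in> R" "dist p y < e / 2"
        by blast
      \<comment> \<open>Both distances differ from \<open>dist x p = dist (g x) q\<close> by at most
        \<open>dist p y = dist (g y) q\<close>.\<close>
      show ?thesis
        using g[OF pq(1), of x] g[OF pq(1), of y] pq(2) dist_triangle2[of "g x" "g y" q]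
          dist_triangle[of "g x" q "g y"] dist_triangle[of x y p] dist_triangle[of x p y]
        by (simp add: dist_commute abs_le_iff)
    qed
    then have "\<bar>dist (g x) (g y) - dist x y\<bar> \<le> 0"
      by (rule field_le_epsilon)
    then show ?thesis by simp
  qed
  note isometric = this
  have "\<exists>x. g x = y" for y
  proof -
    \<comment> \<open>The candidate preimage of \<open>y\<close> is a limit point for the converse
      relation.\<close>
    obtain x where x: "\<And>p q. (p, q) \<in> R \<Longrightarrow> dist y q = dist x p"
      using limit_point_transfer[of "R\<inverse>" y] RD dense(2) by fastforce
    have "dist (g x) y \<le> 0 + e" if "e > 0" for e
    proof -
      have "y \<in> closure (Range R)"
        using dense(2) by simp
      then have "\<exists>q\<in>Range R. dist q y < e / 2"
        unfolding closure_approachable using half_gt_zero[OF that] by blast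
      then obtain p q where pq: "(p, q) \<in> R" "dist q y < e / 2"
        by blast
      show ?thesis
        using x[OF pq(1)] g[OF pq(1), of x] pq(2) dist_triangle[of "g x" y q]
        by (simp add: dist_commute)
    qed
    then have "dist (g x) y \<le> 0"
      by (rule field_le_epsilon)
    then show ?thesis by auto
  qed
  moreover have "inj g"
    by (rule injI) (metis isometric dist_eq_0_iff)
  ultimately have "g \<in> Iso"
    using isometric by (auto simp: Iso_def bij_def surj_def) metis
  moreover have "g p = q" if "(p, q) \<in> R" for p q
    using g[OF that, of p] by simp
  ultimately show ?thesis by blast
qed

lemma back_and_forth_step:
  fixes E :: "('a::urysohn_space \<times> 'a) set"
  assumes "finite E" "realizes dist E"
  shows "\<exists>E'. finite E' \<and> realizes dist E' \<and> E \<subseteq> E' \<and> s \<in> Domain E' \<and> s \<in> Range E'"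
proof -
  obtain z where z: "realizes dist (insert (s, z) E)"
    using one_point_extension[OF assms pseudometric_on_dist] by blast
  have "finite ((insert (s, z) E)\<inverse>)"
    using assms(1) by simp
  from one_point_extension[OF this realizes_converse[OF z] pseudometric_on_dist]
  obtain w where w: "realizes dist (insert (s, w) ((insert (s, z) E)\<inverse>))"
    by blast
  have "(insert (s, w) ((insert (s, z) E)\<inverse>))\<inverse> = insert (w, s) (insert (s, z) E)"
    by auto
  then have "realizes dist (insert (w, s) (insert (s, z) E))"
    using realizes_converse[OF w] by simp
  then show ?thesis
    using assms(1) by (intro exI[of _ "insert (w, s) (insert (s, z) E)"]) auto
qed

text \<open>Back and forth along a countable dense set gives a chain of finite partial isometries
  whose union has dense domain and range.\<close>

theorem ultrahomogeneous:
  fixes E :: "('a::urysohn_space \<times> 'a) set"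
  assumes "finite E" "realizes dist E"
  shows "\<exists>g\<in>Iso. \<forall>p q. (p, q) \<in> E \<longrightarrow> g p = q"
proof -
  obtain S :: "'a set" where S: "countable S" "closure S = UNIV"
  proof -
    obtain D :: "'a set" where D: "countable D" "\<And>X. open X \<Longrightarrow> X \<noteq> {} \<Longrightarrow> \<exists>d\<in>D. d \<in> X"
      using countable_dense_setE by blast
    have "x \<in> closure D" for x
      unfolding closure_approachable
    proof (intro allI impI)
      fix e :: real
      assume "e > 0"
      then have "ball x e \<noteq> {}"
        by simp
      then obtain d where "d \<in> D" "d \<in> ball x e"
        using D(2)[OF open_ball] by blast
      then show "\<exists>d\<in>D. dist d x < e"
        by (auto simp: dist_commute)
    qed
    then have "closure D = UNIV"
      by blast
    with D(1) show thesis
      by (rule that)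
  qed
  \<comment> \<open>This enumeration repeats points when \<open>S\<close> is finite; it requires
    \<open>S\<close> to be nonempty.\<close>
  define s where "s = from_nat_into S"
  have "S \<noteq> {}"
  proof
    assume "S = {}"
    with S(2) show False
      by simp
  qed
  then have s: "range s = S"
    unfolding s_def using S(1) by (rule range_from_nat_into)
  have "\<exists>P. \<forall>n. (finite (P n) \<and> realizes dist (P n) \<and> E \<subseteq> P n) \<and>
      (P n \<subseteq> P (Suc n) \<and> s n \<in> Domain (P (Suc n)) \<and> s n \<in> Range (P (Suc n)))"
  proof (rule dependent_nat_choice)
    show "\<exists>Q. finite Q \<and> realizes dist Q \<and> E \<subseteq> Q"
      using assms by blast
  next
    fix Q :: "('a \<times> 'a) set" and n
    assume Q: "finite Q \<and> realizes dist Q \<and> E \<subseteq> Q"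
    then obtain Q' where "finite Q'" "realizes dist Q'" "Q \<subseteq> Q'" "s n \<in> Domain Q'" "s n \<in> Range Q'"
      using back_and_forth_step[of Q "s n"] by blast
    with Q show "\<exists>Q'. (finite Q' \<and> realizes dist Q' \<and> E \<subseteq> Q') \<and>
        (Q \<subseteq> Q' \<and> s n \<in> Domain Q' \<and> s n \<in> Range Q')"
      by (intro exI[of _ Q']) auto
  qed
  then obtain P where P: "E \<subseteq> P 0" "\<And>n. realizes dist (P n)" "\<And>n. P n \<subseteq> P (Suc n)"
    "\<And>n. s n \<in> Domain (P (Suc n))" "\<And>n. s n \<in> Range (P (Suc n))"
    by blast
  have mono: "P m \<subseteq> P n" if "m \<le> n" for m n
    using P(3) that by (rule lift_Suc_mono_le)
  define R where "R = (\<Union>n. P n)"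
  have PR: "P n \<subseteq> R" for n
    by (auto simp: R_def)
  have "realizes dist R"
    unfolding realizes_def
  proof (intro allI impI)
    fix i x j y
    assume "(i, x) \<in> R" "(j, y) \<in> R"
    then obtain m n where "(i, x) \<in> P m" "(j, y) \<in> P n"
      unfolding R_def by blast
    then have "(i, x) \<in> P (max m n)" "(j, y) \<in> P (max m n)"
      using mono[of m "max m n"] mono[of n "max m n"] by auto
    then show "dist x y = dist i j"
      using realizesD[OF P(2)] by blast
  qed
  moreover have "s n \<in> Domain R" "s n \<in> Range R" for n
    using P(4,5)[of n] PR[of "Suc n"] by blast+
  then have "closure S \<subseteq> closure (Domain R)" "closure S \<subseteq> closure (Range R)"
    using s by (auto intro!: closure_mono)
  then have "closure (Domain R) = UNIV" "closure (Range R) = UNIV"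
    using S(2) by blast+
  ultimately obtain g where "g \<in> Iso" "\<forall>p q. (p, q) \<in> R \<longrightarrow> g p = q"
    using dense_partial_isometry_extends by metis
  then show ?thesis
    using P(1) PR[of 0] by (intro bexI[of _ g]) auto
qed

section \<open>Amalgamation\<close>

text \<open>The distance in the free amalgam over \<open>A\<close>, truncated at \<open>M\<close>. The cap makes the construction
  work also for \<open>A = {}\<close>, where the free amalgam has no finite distances.\<close>

definition capped_path_dist :: "real \<Rightarrow> 'a::metric_space set \<Rightarrow> 'a \<Rightarrow> 'a \<Rightarrow> real" where
  "capped_path_dist M A q b = Min (insert M ((\<lambda>a. dist q a + dist a b) ` A))"

lemma capped_path_dist_le:
  assumes "finite A"
  shows "capped_path_dist M A q b \<le> M"
    and "a \<in> A \<Longrightarrow> capped_path_dist M A q b \<le> dist q a + dist a b"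
  using assms by (auto simp: capped_path_dist_def)

lemma capped_path_dist_cases:
  assumes "finite A"
  obtains "capped_path_dist M A q b = M"
  | a where "a \<in> A" "capped_path_dist M A q b = dist q a + dist a b"
proof -
  have "capped_path_dist M A q b \<in> insert M ((\<lambda>a. dist q a + dist a b) ` A)"
    unfolding capped_path_dist_def using assms by (intro Min_in) auto
  then show thesis
    using that by blast
qed

lemma capped_path_dist_nonneg:
  assumes "finite A" "0 \<le> M"
  shows "0 \<le> capped_path_dist M A q b"
  using assms(1) by (cases rule: capped_path_dist_cases[of A M q b]) (use assms in auto)

text \<open>A detour through \<open>A\<close> is no shorter than \<open>dist q a\<close>, and the
  path via \<open>a\<close> itself attains it. Hence moved points keep their distances to
  \<open>A\<close>.\<close>

lemma capped_path_dist_eq_dist: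
  assumes "finite A" "a \<in> A" "dist q a \<le> M"
  shows "capped_path_dist M A q a = dist q a"
proof (rule antisym)
  show "capped_path_dist M A q a \<le> dist q a"
    using capped_path_dist_le(2)[OF assms(1,2), of M q a] by simp
  show "dist q a \<le> capped_path_dist M A q a"
    using assms(1) by (cases rule: capped_path_dist_cases[of A M q a])
      (use assms(3) dist_triangle in auto)
qed

text \<open>Moving an endpoint changes each path by at most the displacement, and the cap is
  constant.\<close>

lemma capped_path_dist_Lipschitz_right:
  assumes "finite A"
  shows "capped_path_dist M A q b \<le> capped_path_dist M A q b' + dist b b'"
  using assms
proof (cases rule: capped_path_dist_cases[of A M q b'])
  case 1
  then show ?thesis
    using capped_path_dist_le(1)[OF assms, of M q b] zero_le_dist[of b b'] by linarith
next
  case (2 a)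
  then show ?thesis
    using capped_path_dist_le(2)[OF assms 2(1), of M q b] dist_triangle2[of a b b'] by linarith
qed

lemma capped_path_dist_Lipschitz_left:
  assumes "finite A"
  shows "capped_path_dist M A q b \<le> capped_path_dist M A q' b + dist q q'"
  using assms
proof (cases rule: capped_path_dist_cases[of A M q' b])
  case 1
  then show ?thesis
    using capped_path_dist_le(1)[OF assms, of M q b] zero_le_dist[of q q'] by linarith
next
  case (2 a)
  then show ?thesis
    using capped_path_dist_le(2)[OF assms 2(1), of M q b] dist_triangle[of q a q'] by linarith
qed

text \<open>If either term is the cap \<open>M\<close>, the diameter bound suffices; otherwise the
  two paths join at \<open>b\<close> into one from \<open>q\<close> to \<open>q'\<close>.\<close>

lemma dist_le_capped_path_dist_left:
  assumes "finite A" "0 \<le> M" "dist q q' \<le> M"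
  shows "dist q q' \<le> capped_path_dist M A q b + capped_path_dist M A q' b"
proof -
  note nonneg = capped_path_dist_nonneg[OF assms(1,2)]
  show ?thesis
    using assms(1)
  proof (cases rule: capped_path_dist_cases[of A M q b])
    case 1
    then show ?thesis
      using assms(3) nonneg[of q' b] by linarith
  next
    case (2 a)
    note a = this
    show ?thesis
      using assms(1)
    proof (cases rule: capped_path_dist_cases[of A M q' b])
      case 1
      then show ?thesis
        using assms(3) nonneg[of q b] by linarith
    next
      case (2 a')
      then show ?thesis
        using a dist_triangle[of q q' a] dist_triangle[of a q' b] dist_triangle2[of b q' a']
        by (simp add: dist_commute)
    qed
  qed
qed

lemma dist_le_capped_path_dist_right:
  assumes "finite A" "0 \<le> M" "dist b b' \<le> M"
  shows "dist b b' \<le> capped_path_dist M A q b + capped_path_dist M A q b'"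
proof -
  \<comment> \<open>Reversing paths exchanges the two sides of the amalgam.\<close>
  have "capped_path_dist M A q b = capped_path_dist M A b q" for q b
    unfolding capped_path_dist_def by (simp add: dist_commute add.commute)
  then show ?thesis
    using dist_le_capped_path_dist_left[OF assms, of q] by simp
qed

text \<open>The sum type keeps the points of \<open>Q\<close> to be moved apart from the same points in \<open>A \<union> B\<close>.\<close>

fun amalgam_dist :: "real \<Rightarrow> 'a::metric_space set \<Rightarrow> 'a + 'a \<Rightarrow> 'a + 'a \<Rightarrow> real" where
  "amalgam_dist M A (Inl b) (Inl b') = dist b b'"
| "amalgam_dist M A (Inr q) (Inr q') = dist q q'"
| "amalgam_dist M A (Inl b) (Inr q) = capped_path_dist M A q b"
| "amalgam_dist M A (Inr q) (Inl b) = capped_path_dist M A q b"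

lemma pseudometric_on_amalgam_dist:
  assumes "finite A" "0 \<le> M"
    and S: "\<And>b b'. b \<in> S \<Longrightarrow> b' \<in> S \<Longrightarrow> dist b b' \<le> M"
    and Q: "\<And>q q'. q \<in> Q \<Longrightarrow> q' \<in> Q \<Longrightarrow> dist q q' \<le> M"
  shows "pseudometric_on (Inl ` S \<union> Inr ` Q) (amalgam_dist M A)"
  unfolding pseudometric_on_def
proof (intro conjI ballI)
  let ?I = "Inl ` S \<union> Inr ` Q"
  fix i j
  show "i \<in> ?I \<Longrightarrow> amalgam_dist M A i i = 0"
    by (cases i) auto
  show "amalgam_dist M A i j = amalgam_dist M A j i"
    by (cases i; cases j) (auto simp: dist_commute)
next
  let ?I = "Inl ` S \<union> Inr ` Q"
  fix i j k
  assume "i \<in> ?I" "j \<in> ?I" "k \<in> ?I"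
  moreover have "capped_path_dist M A q b \<le> capped_path_dist M A q' b + dist q' q"
      "capped_path_dist M A q b \<le> dist q q' + capped_path_dist M A q' b" for q q' b
    using capped_path_dist_Lipschitz_left[OF assms(1), of M q b q'] by (simp_all add: dist_commute)
  moreover have "capped_path_dist M A q b \<le> capped_path_dist M A q b' + dist b' b"
      "capped_path_dist M A q b \<le> dist b b' + capped_path_dist M A q b'" for q b b'
    using capped_path_dist_Lipschitz_right[OF assms(1), of M q b b'] by (simp_all add: dist_commute)
  ultimately show "amalgam_dist M A i k \<le> amalgam_dist M A i j + amalgam_dist M A j k"
    using dist_le_capped_path_dist_left[OF assms(1,2) Q]
      dist_le_capped_path_dist_right[OF assms(1,2) S]
    by (auto simp: dist_triangle)
qed

text \<open>The amalgam is realised around the actual points of \<open>A \<union> B\<close>. The new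
  copy of \<open>Q\<close> keeps the mutual distances and those to \<open>A\<close>, so
  ultrahomogeneity carries \<open>Q\<close> onto it while fixing \<open>A\<close>.\<close>

lemma amalgamation_step:
  fixes A B Q :: "'a::urysohn_space set"
  assumes fin: "finite A" "finite B" "finite Q"
    and AB: "\<And>b b'. b \<in> A \<union> B \<Longrightarrow> b' \<in> A \<union> B \<Longrightarrow> dist b b' \<le> M"
    and Q: "\<And>q q'. q \<in> Q \<Longrightarrow> q' \<in> Q \<Longrightarrow> dist q q' \<le> M"
    and QA: "\<And>q a. q \<in> Q \<Longrightarrow> a \<in> A \<Longrightarrow> dist q a \<le> M"
  shows "\<exists>k\<in>Iso_fix A. \<forall>q\<in>Q. \<forall>b\<in>B. dist (k q) b = capped_path_dist M A q b"
\<comment> \<open>A point of \<open>Q\<close> forces \<open>0 \<le> M\<close>; for empty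
  \<open>Q\<close> the identity serves.\<close>
proof (cases "Q = {}")
  case True
  then show ?thesis
    by (intro bexI[of _ id]) (auto simp: Iso_fix_def Iso_def)
next
  case False
  then have M: "0 \<le> M"
    using Q by fastforce
  define E where "E = (\<lambda>b. (Inl b :: 'a + 'a, b)) ` (A \<union> B)"
  have "realizes (amalgam_dist M A) E"
    by (auto simp: realizes_def E_def)
  moreover have "Domain E = Inl ` (A \<union> B)"
    by (auto simp: E_def Domain_unfold)
  moreover have "pseudometric_on (Inl ` (A \<union> B) \<union> Inr ` Q) (amalgam_dist M A)"
    by (rule pseudometric_on_amalgam_dist[OF fin(1) M AB Q])
  moreover have "finite (Inr ` Q :: ('a + 'a) set)" "finite E"
    using fin by (auto simp: E_def)
  ultimately obtain E' where E': "E \<subseteq> E'" "realizes (amalgam_dist M A) E'"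
      "Domain E' = Inr ` Q \<union> Inl ` (A \<union> B)"
    using realization_extension[of "Inr ` Q" E "amalgam_dist M A"]
    by (metis Un_commute)
  have "\<forall>q\<in>Q. \<exists>z. (Inr q, z) \<in> E'"
    using E'(3) by blast
  then obtain e where e: "\<And>q. q \<in> Q \<Longrightarrow> (Inr q, e q) \<in> E'"
    by metis
  have E'_Inl: "(Inl b, b) \<in> E'" if "b \<in> A \<union> B" for b
    using that E'(1) by (auto simp: E_def)
  have eb: "dist (e q) b = capped_path_dist M A q b" if "q \<in> Q" "b \<in> A \<union> B" for q b
    using realizesD[OF E'(2) e[OF that(1)] E'_Inl[OF that(2)]] by simp
  have ee: "dist (e q) (e q') = dist q q'" if "q \<in> Q" "q' \<in> Q" for q q'
    using realizesD[OF E'(2) e[OF that(1)] e[OF that(2)]] by simp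
  have ea: "dist (e q) a = dist q a" if "q \<in> Q" "a \<in> A" for q a
    using eb[of q a] capped_path_dist_eq_dist[OF fin(1) that(2) QA[OF that]] that by simp
  define P where "P = (\<lambda>q. (q, e q)) ` Q \<union> (\<lambda>a. (a, a)) ` A"
  have "realizes dist P"
    unfolding realizes_def P_def using ee ea by (auto simp: dist_commute)
  moreover have "finite P"
    using fin by (simp add: P_def)
  ultimately obtain k where k: "k \<in> Iso" "\<And>p q. (p, q) \<in> P \<Longrightarrow> k p = q"
    using ultrahomogeneous by blast
  have "k \<in> Iso_fix A" "\<And>q. q \<in> Q \<Longrightarrow> k q = e q"
    using k by (auto simp: P_def Iso_fix_def)
  then show ?thesis
    using eb by (intro bexI[of _ k]) auto
qed

section \<open>Alternating between the two stabilisers\<close>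

lemma Iso_dist: "g \<in> Iso \<Longrightarrow> dist (g x) (g y) = dist x y"
  by (simp add: Iso_def)

lemma dist_Iso_fix: "h \<in> Iso_fix C \<Longrightarrow> c \<in> C \<Longrightarrow> dist (h x) c = dist x c"
  unfolding Iso_fix_def using Iso_dist[of h x c] by auto

text \<open>The new distance from \<open>h q\<close> to \<open>b\<close> is \<open>M\<close>, or is
  attained through \<open>A \<inter> B\<close>, to which \<open>h\<close> preserves distances, or
  ends with a jump from \<open>A - B\<close> to \<open>B\<close> costing at least
  \<open>\<delta>\<close>.\<close>

lemma spread_step:
  fixes A B F :: "'a::urysohn_space set"
  assumes fin: "finite A" "finite B" "finite F"
    and h: "h \<in> Iso_fix (A \<inter> B)"
    and AB: "\<And>b b'. b \<in> A \<union> B \<Longrightarrow> b' \<in> A \<union> B \<Longrightarrow> dist b b' \<le> M"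
    and F: "\<And>q q'. q \<in> F \<Longrightarrow> q' \<in> F \<Longrightarrow> dist q q' \<le> M"
    and hF: "\<And>q a. q \<in> F \<Longrightarrow> a \<in> A \<Longrightarrow> dist (h q) a \<le> M"
    and sep: "\<And>a b. a \<in> A \<Longrightarrow> b \<in> B \<Longrightarrow> a \<noteq> b \<Longrightarrow> \<delta> \<le> dist a b"
    and lower: "\<And>q a. q \<in> F \<Longrightarrow> a \<in> A \<Longrightarrow> min (capped_path_dist M (A \<inter> B) q a) r \<le> dist (h q) a"
  shows "\<exists>k\<in>Iso_fix A. \<forall>q\<in>F. \<forall>b\<in>B. dist (k (h q)) b \<le> M \<and>
    min (capped_path_dist M (A \<inter> B) q b) (r + \<delta>) \<le> dist (k (h q)) b"
proof -
  have "h \<in> Iso"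
    using h by (simp add: Iso_fix_def)
  have finC: "finite (A \<inter> B)"
    using fin by simp
  have "\<exists>k\<in>Iso_fix A. \<forall>q\<in>h ` F. \<forall>b\<in>B. dist (k q) b = capped_path_dist M A q b"
    by (rule amalgamation_step) (use fin AB F hF Iso_dist[OF \<open>h \<in> Iso\<close>] in auto)
  then obtain k where k: "k \<in> Iso_fix A"
    "\<And>q b. q \<in> F \<Longrightarrow> b \<in> B \<Longrightarrow> dist (k (h q)) b = capped_path_dist M A (h q) b"
    by blast
  have "min (capped_path_dist M (A \<inter> B) q b) (r + \<delta>) \<le> capped_path_dist M A (h q) b"
    if qb: "q \<in> F" "b \<in> B" for q b
    using fin(1)
  proof (cases rule: capped_path_dist_cases[of A M "h q" b])
    case 1
    then show ?thesis
      using capped_path_dist_le(1)[OF finC, of M q b] by linarith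
  next
    case (2 a)
    show ?thesis
    proof (cases "a \<in> B")
      case True
      then show ?thesis
        using 2 dist_Iso_fix[OF h, of a q] capped_path_dist_le(2)[OF finC, of a M q b] by simp
    next
      \<comment> \<open>Of the two terms in \<open>lower\<close>, \<open>r\<close> gains
        \<open>\<delta>\<close>, while the capped distance at \<open>a\<close> plus
        \<open>dist a b\<close> dominates the one at \<open>b\<close>.\<close>
      case False
      then have "\<delta> \<le> dist a b"
        using sep 2(1) qb by blast
      then show ?thesis
        using 2(2) lower[OF qb(1) 2(1)] dist_commute[of a b]
          capped_path_dist_Lipschitz_right[OF finC, of M q b a] by linarith
    qed
  qed
  then show ?thesis
    using k capped_path_dist_le(1)[OF fin(1)] by (intro bexI[of _ k]) auto
qed

section \<open>The stabilisers and the group they generate\<close>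

lemma subgroup_Iso_fix: "subgroup (Iso_fix C) Iso_group"
proof (rule group.subgroupI[OF group_Iso_group])
  show "Iso_fix C \<subseteq> carrier Iso_group"
    by (auto simp: Iso_group_def Iso_fix_def)
  show "Iso_fix C \<noteq> {}"
    by (auto simp: Iso_fix_def Iso_def intro!: exI[of _ id])
  fix g h
  assume g: "g \<in> Iso_fix C" and h: "h \<in> Iso_fix C"
  then show "g \<otimes>\<^bsub>Iso_group\<^esub> h \<in> Iso_fix C"
    by (auto simp: Iso_group_def Iso_fix_def Iso_def bij_comp)
  have gc: "g \<in> carrier Iso_group"
    using g by (auto simp: Iso_group_def Iso_fix_def)
  interpret group Iso_group
    by (rule group_Iso_group)
  have "inv\<^bsub>Iso_group\<^esub> g \<circ> g = id"
    using l_inv[OF gc] by (simp add: Iso_group_def)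
  then have "(inv\<^bsub>Iso_group\<^esub> g) (g x) = x" for x
    by (metis comp_apply id_apply)
  moreover have "inv\<^bsub>Iso_group\<^esub> g \<in> Iso"
    using inv_closed[OF gc] by (simp add: Iso_group_def)
  ultimately show "inv\<^bsub>Iso_group\<^esub> g \<in> Iso_fix C"
    using g unfolding Iso_fix_def by auto metis
qed

abbreviation joint_group :: "'a::metric_space set \<Rightarrow> 'a set \<Rightarrow> ('a \<Rightarrow> 'a) set" where
  "joint_group A B \<equiv> generate Iso_group (Iso_fix A \<union> Iso_fix B)"

lemma subgroup_joint_group: "subgroup (joint_group A B) Iso_group"
  by (rule group.generate_is_subgroup[OF group_Iso_group]) (auto simp: Iso_group_def Iso_fix_def)

lemma joint_group_subset: "joint_group A B \<subseteq> Iso_fix (A \<inter> B)"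
  by (rule group.generate_subgroup_incl[OF group_Iso_group _ subgroup_Iso_fix])
    (auto simp: Iso_fix_def)

lemma joint_group_comp:
  "g \<in> joint_group A B \<Longrightarrow> h \<in> joint_group A B \<Longrightarrow> (\<lambda>x. g (h x)) \<in> joint_group A B"
  using generate.eng[of g Iso_group "Iso_fix A \<union> Iso_fix B" h]
  by (simp add: Iso_group_def comp_def)

text \<open>The upper bound is the triangle inequality through \<open>A \<inter> B\<close>, which
  \<open>h\<close> fixes. The lower bound rises by \<open>\<delta>\<close> with each round of moves
  until it reaches the cap.\<close>

lemma canonical_position:
  fixes A B F :: "'a::urysohn_space set"
  assumes fin: "finite A" "finite B" "finite F"
    and M: "\<And>x y. x \<in> A \<union> B \<union> F \<Longrightarrow> y \<in> A \<union> B \<union> F \<Longrightarrow> dist x y \<le> M"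
  shows "\<exists>h\<in>joint_group A B. \<forall>q\<in>F. \<forall>b\<in>A \<union> B. dist (h q) b = capped_path_dist M (A \<inter> B) q b"
proof -
  let ?T = "capped_path_dist M (A \<inter> B)"
  have finC: "finite (A \<inter> B)"
    using fin by simp
  \<comment> \<open>The element 1 keeps the minimum defined when \<open>A \<times> B\<close> has no
    pair of distinct points.\<close>
  define D where "D = insert 1 ((\<lambda>(a, b). dist a b) ` {p \<in> A \<times> B. fst p \<noteq> snd p})"
  define \<delta> where "\<delta> = Min D"
  have finD: "finite D" "D \<noteq> {}"
    using fin by (auto simp: D_def)
  have "\<forall>d\<in>D. 0 < d"
    by (auto simp: D_def)
  then have \<delta>: "0 < \<delta>"
    using finD by (simp add: \<delta>_def)
  have sep: "\<delta> \<le> dist a b" if "a \<in> A" "b \<in> B" "a \<noteq> b" for a b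
    unfolding \<delta>_def using that by (intro Min_le finD) (force simp: D_def)
  \<comment> \<open>One round is a move over \<open>A\<close> followed by one over \<open>B\<close>.
    For \<open>n = 0\<close> the lower bound is at most 0.\<close>
  have "\<exists>h\<in>joint_group A B. \<forall>q\<in>F. \<forall>b\<in>A \<union> B. dist (h q) b \<le> M \<and> min (?T q b) (n * \<delta>) \<le> dist (h q) b"
    for n :: nat
  proof (induction n)
    case 0
    have "id \<in> joint_group A B"
      by (rule generate.incl) (auto simp: Iso_fix_def Iso_def)
    then show ?case
      using M by (intro bexI[of _ id]) (auto simp: min.coboundedI2)
  next
    case (Suc n)
    then obtain h where h: "h \<in> joint_group A B"
      "\<And>q b. q \<in> F \<Longrightarrow> b \<in> A \<union> B \<Longrightarrow> dist (h q) b \<le> M"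
      "\<And>q b. q \<in> F \<Longrightarrow> b \<in> A \<union> B \<Longrightarrow> min (?T q b) (n * \<delta>) \<le> dist (h q) b"
      by blast
    have "h \<in> Iso_fix (A \<inter> B)"
      using h(1) joint_group_subset by blast
    then have "\<exists>k\<in>Iso_fix A. \<forall>q\<in>F. \<forall>b\<in>B. dist (k (h q)) b \<le> M \<and>
        min (?T q b) (n * \<delta> + \<delta>) \<le> dist (k (h q)) b"
      by (rule spread_step[OF fin]) (use M h(2,3) sep in auto)
    then obtain k where k: "k \<in> Iso_fix A"
      "\<And>q b. q \<in> F \<Longrightarrow> b \<in> B \<Longrightarrow> dist (k (h q)) b \<le> M"
      "\<And>q b. q \<in> F \<Longrightarrow> b \<in> B \<Longrightarrow> min (?T q b) (n * \<delta> + \<delta>) \<le> dist (k (h q)) b"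
      by blast
    have kh: "(\<lambda>x. k (h x)) \<in> joint_group A B"
      by (rule joint_group_comp) (use k h in \<open>auto intro: generate.incl\<close>)
    then have "(\<lambda>x. k (h x)) \<in> Iso_fix (B \<inter> A)"
      using joint_group_subset by (metis Int_commute subsetD)
    moreover have "\<delta> \<le> dist b a" if "b \<in> B" "a \<in> A" "b \<noteq> a" for a b
      using sep[of a b] that by (simp add: dist_commute)
    ultimately have "\<exists>l\<in>Iso_fix B. \<forall>q\<in>F. \<forall>a\<in>A. dist (l (k (h q))) a \<le> M \<and>
        min (capped_path_dist M (B \<inter> A) q a) (n * \<delta> + \<delta> + \<delta>) \<le> dist (l (k (h q))) a"
      by (intro spread_step[OF fin(2,1,3)]) (use M k(2,3) in \<open>auto simp: Int_commute\<close>)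
    then obtain l where l: "l \<in> Iso_fix B"
      "\<And>q a. q \<in> F \<Longrightarrow> a \<in> A \<Longrightarrow> dist (l (k (h q))) a \<le> M"
      "\<And>q a. q \<in> F \<Longrightarrow> a \<in> A \<Longrightarrow> min (?T q a) (n * \<delta> + \<delta> + \<delta>) \<le> dist (l (k (h q))) a"
      unfolding Int_commute[of B A] by blast
    \<comment> \<open>The second move fixes \<open>B\<close>, so the gain of the first move on
      \<open>B\<close> persists.\<close>
    have lb: "dist (l (k (h q))) b = dist (k (h q)) b" if "b \<in> B" for q b
      using dist_Iso_fix[OF l(1) that] .
    have "dist (l (k (h q))) b \<le> M \<and> min (?T q b) (n * \<delta> + \<delta>) \<le> dist (l (k (h q))) b"
      if q: "q \<in> F" and b: "b \<in> A \<union> B" for q b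
    proof (cases "b \<in> B")
      case True
      then show ?thesis
        using k(2,3)[OF q True] lb[OF True] by simp
    next
      case False
      then have "b \<in> A"
        using b by simp
      then show ?thesis
        using l(2,3)[OF q] \<delta> by fastforce
    qed
    moreover have "(\<lambda>x. l (k (h x))) \<in> joint_group A B"
      by (rule joint_group_comp) (use kh l in \<open>auto intro: generate.incl\<close>)
    ultimately show ?case
      by (intro bexI[of _ "\<lambda>x. l (k (h x))"]) (auto simp: algebra_simps)
  qed
  note approach = this
  \<comment> \<open>From here on \<open>n * \<delta>\<close> is at least every capped distance, so
    the minimum is the capped distance itself.\<close>
  obtain n :: nat where n: "M \<le> n * \<delta>"
    using reals_Archimedean3[OF \<delta>] less_imp_le by blast
  obtain h where h: "h \<in> joint_group A B"
    "\<And>q b. q \<in> F \<Longrightarrow> b \<in> A \<union> B \<Longrightarrow> dist (h q) b \<le> M \<and> min (?T q b) (n * \<delta>) \<le> dist (h q) b"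
    using approach[of n] by blast
  have "h \<in> Iso_fix (A \<inter> B)"
    using h(1) joint_group_subset by blast
  have "dist (h q) b = ?T q b" if qb: "q \<in> F" "b \<in> A \<union> B" for q b
  proof (rule antisym)
    show "?T q b \<le> dist (h q) b"
      using h(2)[OF qb] n capped_path_dist_le(1)[OF finC, of M q b] by linarith
    show "dist (h q) b \<le> ?T q b"
      using finC
    proof (cases rule: capped_path_dist_cases[of "A \<inter> B" M q b])
      case 1
      then show ?thesis
        using h(2)[OF qb] by simp
    next
      case (2 c)
      then show ?thesis
        using dist_triangle[of "h q" b c] dist_Iso_fix[OF \<open>h \<in> Iso_fix (A \<inter> B)\<close> 2(1), of q] by simp
    qed
  qed
  then show ?thesis
    using h(1) by blast
qed

lemma agrees_on_finite_set:
  fixes A B F :: "'a::urysohn_space set"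
  assumes fin: "finite A" "finite B" "finite F" and g: "g \<in> Iso_fix (A \<inter> B)"
  shows "\<exists>h\<in>joint_group A B. \<forall>x\<in>F. h x = g x"
proof -
  \<comment> \<open>A single \<open>h\<close> brings \<open>F\<close> and \<open>g ` F\<close> to canonical position; \<open>u\<close> below matches the two images.\<close>
  let ?X = "A \<union> B \<union> (F \<union> g ` F)"
  have "g \<in> Iso"
    using g by (simp add: Iso_fix_def)
  have "bounded ?X"
    using fin by (intro finite_imp_bounded) simp
  then obtain M where M: "\<And>x y. x \<in> ?X \<Longrightarrow> y \<in> ?X \<Longrightarrow> dist x y \<le> M"
    using bounded_two_points[of ?X] by metis
  obtain h where h: "h \<in> joint_group A B"
    "\<And>q b. q \<in> F \<union> g ` F \<Longrightarrow> b \<in> A \<union> B \<Longrightarrow> dist (h q) b = capped_path_dist M (A \<inter> B) q b"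
    using canonical_position[of A B "F \<union> g ` F" M] fin M by blast
  have hI: "h \<in> Iso"
    using h(1) joint_group_subset by (auto simp: Iso_fix_def)
  \<comment> \<open>Points outside \<open>A \<inter> B\<close> enter only through \<open>b\<close>,
    and \<open>g\<close> preserves distances to \<open>A \<inter> B\<close>.\<close>
  have same: "capped_path_dist M (A \<inter> B) (g q) b = capped_path_dist M (A \<inter> B) q b" for q b
  proof -
    have "(\<lambda>a. dist (g q) a + dist a b) ` (A \<inter> B) = (\<lambda>a. dist q a + dist a b) ` (A \<inter> B)"
      by (rule image_cong) (use dist_Iso_fix[OF g] in simp_all)
    then show ?thesis
      by (simp add: capped_path_dist_def)
  qed
  define P where "P = (\<lambda>x. (h x, h (g x))) ` F \<union> (\<lambda>a. (a, a)) ` (A \<union> B)"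
  have "dist (h (g x)) b = dist (h x) b" if "x \<in> F" "b \<in> A \<union> B" for x b
    using h(2)[of "g x" b] h(2)[of x b] same[of x b] that by simp
  then have "realizes dist P"
    unfolding realizes_def P_def using Iso_dist[OF hI] Iso_dist[OF \<open>g \<in> Iso\<close>]
    by (auto simp: dist_commute)
  moreover have "finite P"
    using fin by (simp add: P_def)
  ultimately obtain u where u: "u \<in> Iso" "\<And>p q. (p, q) \<in> P \<Longrightarrow> u p = q"
    using ultrahomogeneous by blast
  have "u \<in> Iso_fix A" and uh: "\<And>x. x \<in> F \<Longrightarrow> u (h x) = h (g x)"
    using u by (auto simp: P_def Iso_fix_def)
  then have "u \<in> joint_group A B"
    by (auto intro: generate.incl)
  then have uh': "(\<lambda>x. u (h x)) \<in> joint_group A B"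
    using h(1) joint_group_comp by blast
  \<comment> \<open>The conjugate of \<open>u\<close> by \<open>h\<close> agrees with
    \<open>g\<close> on \<open>F\<close>, because \<open>u\<close> sends \<open>h x\<close> to
    \<open>h (g x)\<close>.\<close>
  let ?i = "inv\<^bsub>Iso_group\<^esub> h"
  have "?i \<in> joint_group A B"
    using subgroup.m_inv_closed[OF subgroup_joint_group h(1)] .
  then have "(\<lambda>x. ?i (u (h x))) \<in> joint_group A B"
    using uh' joint_group_comp by blast
  moreover have "?i \<circ> h = id"
    using group.l_inv[OF group_Iso_group, of h] hI by (simp add: Iso_group_def)
  then have "?i (u (h x)) = g x" if "x \<in> F" for x
    using uh[OF that] by (metis comp_apply id_apply)
  ultimately show ?thesis
    by (intro bexI[of _ "\<lambda>x. ?i (u (h x))"]) auto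
qed

section \<open>Passage to the closure in the pointwise topology\<close>

lemma closed_Iso_fix: "closedin (top_of_set Iso) (Iso_fix C)"
proof -
  have "closed {g :: 'a \<Rightarrow> 'a::metric_space. g c = c}" for c
    by (intro closed_Collect_eq continuous_on_product_coordinates continuous_on_const)
  then have "closed (\<Inter>c\<in>C. {g :: 'a \<Rightarrow> 'a. g c = c})"
    by (intro closed_INT ballI)
  moreover have "Iso_fix C = Iso \<inter> (\<Inter>c\<in>C. {g. g c = c})"
    by (auto simp: Iso_fix_def)
  ultimately show ?thesis
    unfolding closedin_closed by (intro exI conjI)
qed

text \<open>The stabiliser of \<open>A \<inter> B\<close> is closed and contains the generated
  group; agreement on finite sets makes that group dense in it.\<close>

theorem theorem5p7:
  fixes A B :: "'a::urysohn_space set"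
  assumes "finite A" and "finite B"
  shows "Iso_fix (A \<inter> B) = closed_subgroup_generated (Iso_fix A \<union> Iso_fix B)"
proof
  show "closed_subgroup_generated (Iso_fix A \<union> Iso_fix B) \<subseteq> Iso_fix (A \<inter> B)"
    unfolding closed_subgroup_generated_def
    by (rule closure_of_minimal[OF joint_group_subset closed_Iso_fix])
  show "Iso_fix (A \<inter> B) \<subseteq> closed_subgroup_generated (Iso_fix A \<union> Iso_fix B)"
  proof
    fix g
    assume g: "g \<in> Iso_fix (A \<inter> B)"
    have "\<exists>h\<in>joint_group A B. h \<in> U" if U: "g \<in> U" "open U" for U
    proof -
      \<comment> \<open>A basic neighbourhood restricts only finitely many coordinates, and agreeing
        with \<open>g\<close> on these is enough to lie in it.\<close>
      have "openin (product_topology (\<lambda>i. euclidean) UNIV) U"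
        using U(2) by (simp add: open_fun_def)
      then obtain X where X: "g \<in> (\<Pi>\<^sub>E i\<in>UNIV. X i)" "finite {i. X i \<noteq> UNIV}"
          "(\<Pi>\<^sub>E i\<in>UNIV. X i) \<subseteq> U"
        using product_topology_open_contains_basis[of "\<lambda>i. euclidean" UNIV U g] U(1) by auto
      obtain h where h: "h \<in> joint_group A B" "\<And>x. X x \<noteq> UNIV \<Longrightarrow> h x = g x"
        using agrees_on_finite_set[OF assms X(2) g] by blast
      have "h x \<in> X x" for x
        using h(2)[of x] X(1) by (cases "X x = UNIV") auto
      then show ?thesis
        using h(1) X(3) by blast
    qed
    moreover have "joint_group A B \<subseteq> Iso"
      using joint_group_subset by (auto simp: Iso_fix_def)
    ultimately have "\<exists>h\<in>joint_group A B. h \<in> Iso \<inter> U" if "g \<in> U" "open U" for U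
      using that by (meson IntI subsetD)
    then show "g \<in> closed_subgroup_generated (Iso_fix A \<union> Iso_fix B)"
      using g unfolding closed_subgroup_generated_def in_closure_of openin_open Iso_fix_def
      by auto
  qed
qed

end
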